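(* Let $G=(V,E,l)$ be a finite connected undirected simple metric graph, and let $v^*\in V$. Suppose that there exist two closed walks $C_1$ and $C_2$ based at $v^*$ whose metric lengths $A=l(C_1)$ and $B=l(C_2)$ satisfy $\frac{A}{B}\notin\mathbb Q$. For every vertex $u\in V$, fix a path $P_u$ from $v^*$ to $u$, and write $p_u=l(P_u)$ for its metric length. Then, for every $0<\varepsilon<\min_{e\in E}l(e)$, the moment $\tau_s(\varepsilon)$ of permanent $\varepsilon$-saturation of the dynamics $\mathcal W(G,v^* )$ satisfies $$\tau_s(\varepsilon)\le\max_{a=(u\to w)\in\overrightarrow E}\bigl(p_u+A\,N_{A,B}(\varepsilon)+B+l(a)\bigr),$$ where $N_{A,B}(\varepsilon)$ is the covering time of the rotation $R_{A,B}(x)=x+A \pmod B$ on $\mathbb R/B\mathbb Z$.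
   Context: A metric graph $G=(V,E,l)$ is a graph $(V,E)$ with a length function $l:E\to\mathbb R_{>0}$; each edge $e$ is identified with an interval of length $l(e)$. Graphs are undirected and simple (no loops, at most one edge between two vertices). $\overrightarrow E$ is the set of oriented edges: each edge $\{u,w\}$ gives two oriented edges $u\to w$ and $w\to u$. For $a=(u\to w)$ put $l(a)=l(\{u,w\})$. A walk is a finite sequence of vertices $(v_0,\dots,v_n)$ with $\{v_{i-1},v_i\}\in E$ for all $i$; its metric length is $\sum_{i=1}^n l(\{v_{i-1},v_i\})$. The empty walk has length $0$ (so the path from $v^*$ to itself may be taken empty). A closed walk based at $v^*$ is a walk with $v_0=v_n=v^*$. The dynamics $\mathcal W(G,v^* )$ (time $t\in\mathbb R_{\ge 0}$, space $V\cup\bigsqcup_{e\in E}e$, i.e. the metric graph): each moving point lies on an oriented edge and moves at unit speed toward its head. When a moving point reaches a vertex $v$, it is removed and new moving points are created at $v$, one on each oriented edge issuing from $v$ (including the reverse of the edge along which it arrived), each moving away from $v$ at unit speed. At time $0$ moving points are created at $v^*$ on all oriented edges issuing from $v^*$. The system is $\varepsilon$-saturated at time $t$ if the moving points at time $t$ form an $\varepsilon$-net of the metric graph (every point is within distance at most $\varepsilon$ of some moving point). The moment of permanent $\varepsilon$-saturation $\tau_s(\varepsilon)$ is the infimum of the maximal time interval, unbounded to the right, on which the system is $\varepsilon$-saturated; i.e. $\tau_s(\varepsilon)=\inf\{t_0\ge0:\mathcal W(G,v^* )\text{ is }\varepsilon\text{-saturated at every }t\ge t_0\}$ (with $\inf\emptyset=+\infty$).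 Covering time: for $A,B>0$ with $A/B\notin\mathbb Q$ and $N\ge1$, let $S_N(A,B)=\{nA \bmod B:0\le n\le N\}\subset\mathbb R/B\mathbb Z$. It has circular gaps at most $\delta$ if, after ordering its points cyclically on the circle $\mathbb R/B\mathbb Z$ of length $B$, every gap between adjacent points has length at most $\delta$. For $\delta>0$, $N_{A,B}(\delta)=\min\{N\ge1: S_N(A,B)\text{ has circular gaps at most }\delta\}$ (finite by irrationality). *)

theory Defs
  imports "HOL-Analysis.Analysis" "HOL-Library.Real_Mod"
begin

section \<open>Metric graphs and walks\<close>

record 'v mgraph =
  verts :: "'v set"
  edges :: "'v set set"
  len :: "'v set \<Rightarrow> real"

text \<open>Edges are two-element vertex sets, which rules out loops and multiple edges.\<close>

definition metric_graph :: "'v mgraph \<Rightarrow> bool" where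
  "metric_graph G \<longleftrightarrow>
     (\<forall>e\<in>edges G. \<exists>u\<in>verts G. \<exists>w\<in>verts G. u \<noteq> w \<and> e = {u, w}) \<and>
     (\<forall>e\<in>edges G. 0 < len G e)"

definition oriented_edges :: "'v mgraph \<Rightarrow> ('v \<times> 'v) set" where
  "oriented_edges G = {(u, w). {u, w} \<in> edges G}"

definition olen :: "'v mgraph \<Rightarrow> 'v \<times> 'v \<Rightarrow> real" where
  "olen G a = len G {fst a, snd a}"

text \<open>A walk is given by its nonempty list of vertices; the empty walk at \<open>v\<close> is \<open>[v]\<close>.\<close>

definition walk_from_to :: "'v mgraph \<Rightarrow> 'v \<Rightarrow> 'v list \<Rightarrow> 'v \<Rightarrow> bool" where
  "walk_from_to G u xs w \<longleftrightarrow>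
     xs \<noteq> [] \<and> hd xs = u \<and> last xs = w \<and> set xs \<subseteq> verts G \<and>
     (\<forall>i. Suc i < length xs \<longrightarrow> {xs ! i, xs ! Suc i} \<in> edges G)"

definition walk_length :: "'v mgraph \<Rightarrow> 'v list \<Rightarrow> real" where
  "walk_length G xs = (\<Sum>i<length xs - 1. len G {xs ! i, xs ! Suc i})"

abbreviation closed_walk :: "'v mgraph \<Rightarrow> 'v \<Rightarrow> 'v list \<Rightarrow> bool" where
  "closed_walk G v xs \<equiv> walk_from_to G v xs v"

definition connected_graph :: "'v mgraph \<Rightarrow> bool" where
  "connected_graph G \<longleftrightarrow> (\<forall>u\<in>verts G. \<forall>w\<in>verts G. \<exists>xs. walk_from_to G u xs w)"

section \<open>The space of a metric graph\<close>

text \<open>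
  A point of the metric graph is given by its barycentric coordinates in the geometric
  realization of the graph: a vertex is its own indicator function, and the point at distance \<open>x\<close>
  from \<open>u\<close> on the edge \<open>{u, w}\<close> of length \<open>l\<close> has coordinate \<open>1 - x / l\<close> at \<open>u\<close> and \<open>x / l\<close> at \<open>w\<close>.
  In this way the ends of an edge coincide with its end vertices, and the two orientations of
  an edge parametrize the same set of points (\<open>edge_point_reverse\<close>).
\<close>

definition vertex_point :: "'v \<Rightarrow> 'v \<Rightarrow> real" where
  "vertex_point v = (\<lambda>z. if z = v then 1 else 0)"

definition edge_point :: "'v mgraph \<Rightarrow> 'v \<times> 'v \<Rightarrow> real \<Rightarrow> 'v \<Rightarrow> real" where
  "edge_point G a x =
     (\<lambda>z. if z = fst a then 1 - x / olen G a else if z = snd a then x / olen G a else 0)"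

definition graph_points :: "'v mgraph \<Rightarrow> ('v \<Rightarrow> real) set" where
  "graph_points G =
     vertex_point ` verts G \<union>
     {edge_point G a x | a x. a \<in> oriented_edges G \<and> 0 \<le> x \<and> x \<le> olen G a}"

lemma edge_point_0: "edge_point G (u, w) 0 = vertex_point u"
  by (auto simp: edge_point_def vertex_point_def)

lemma edge_point_reverse:
  assumes "metric_graph G" "(u, w) \<in> oriented_edges G"
  shows "edge_point G (w, u) x = edge_point G (u, w) (olen G (u, w) - x)"
proof -
  have e: "{u, w} \<in> edges G" using assms(2) by (simp add: oriented_edges_def)
  then have "u \<noteq> w" using assms(1) unfolding metric_graph_def by fastforce
  moreover have "0 < len G {u, w}" using assms(1) e by (auto simp: metric_graph_def)
  ultimately show ?thesis
    by (auto simp: edge_point_def olen_def insert_commute diff_divide_distrib)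
qed

text \<open>
  \<open>path_between G p q r\<close>: one can travel from \<open>p\<close> to \<open>q\<close> by finitely many moves, each inside a
  single closed edge, of total length \<open>r\<close>. The distance is the induced intrinsic metric; it is
  extended-real valued only in order to be \<open>\<infinity>\<close> between different components.
\<close>

inductive path_between :: "'v mgraph \<Rightarrow> ('v \<Rightarrow> real) \<Rightarrow> ('v \<Rightarrow> real) \<Rightarrow> real \<Rightarrow> bool"
  for G :: "'v mgraph" and p :: "'v \<Rightarrow> real" where
  start: "p \<in> graph_points G \<Longrightarrow> path_between G p p 0"
| move: "path_between G p (edge_point G a x) r \<Longrightarrow> a \<in> oriented_edges G \<Longrightarrow>
    x \<in> {0..olen G a} \<Longrightarrow> y \<in> {0..olen G a} \<Longrightarrow>
    path_between G p (edge_point G a y) (r + \<bar>x - y\<bar>)"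

definition graph_dist :: "'v mgraph \<Rightarrow> ('v \<Rightarrow> real) \<Rightarrow> ('v \<Rightarrow> real) \<Rightarrow> ereal" where
  "graph_dist G p q = Inf {ereal r | r. path_between G p q r}"

section \<open>The dynamics and its saturation\<close>

text \<open>
  \<open>created G v\<^sub>0 s a\<close>: in the dynamics started at \<open>v\<^sub>0\<close>, a moving point is created at time \<open>s\<close>
  at the tail of the oriented edge \<open>a\<close>.
\<close>

inductive created :: "'v mgraph \<Rightarrow> 'v \<Rightarrow> real \<Rightarrow> 'v \<times> 'v \<Rightarrow> bool"
  for G :: "'v mgraph" and v\<^sub>0 :: 'v where
  initial: "(v\<^sub>0, w) \<in> oriented_edges G \<Longrightarrow> created G v\<^sub>0 0 (v\<^sub>0, w)"
| arrival: "created G v\<^sub>0 s (u, w) \<Longrightarrow> (w, z) \<in> oriented_edges G \<Longrightarrow>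
    created G v\<^sub>0 (s + olen G (u, w)) (w, z)"

text \<open>
  A pair \<open>(a, x)\<close> stands for a moving point on the oriented edge \<open>a\<close> at distance \<open>x\<close> from the tail
  of \<open>a\<close>. A point created at time \<open>s\<close> is removed at time \<open>s + olen G a\<close>, when its
  place is taken by the points created at the head of \<open>a\<close>.
\<close>

definition moving_points :: "'v mgraph \<Rightarrow> 'v \<Rightarrow> real \<Rightarrow> (('v \<times> 'v) \<times> real) set" where
  "moving_points G v\<^sub>0 t = {(a, t - s) | a s. created G v\<^sub>0 s a \<and> s \<le> t \<and> t < s + olen G a}"

definition saturated :: "'v mgraph \<Rightarrow> 'v \<Rightarrow> real \<Rightarrow> real \<Rightarrow> bool" where
  "saturated G v\<^sub>0 \<epsilon> t \<longleftrightarrow>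
     (\<forall>q\<in>graph_points G. \<exists>(a, x)\<in>moving_points G v\<^sub>0 t.
        graph_dist G q (edge_point G a x) \<le> ereal \<epsilon>)"

definition saturation_moment :: "'v mgraph \<Rightarrow> 'v \<Rightarrow> real \<Rightarrow> ereal" where
  "saturation_moment G v\<^sub>0 \<epsilon> =
     Inf {ereal t\<^sub>0 | t\<^sub>0. 0 \<le> t\<^sub>0 \<and> (\<forall>t\<ge>t\<^sub>0. saturated G v\<^sub>0 \<epsilon> t)}"

section \<open>Covering time of a rotation\<close>

text \<open>
  The circle \<open>\<real> / B\<int>\<close> is represented by the interval \<open>[0, B)\<close>. The gaps of a finite nonempty
  subset are the differences of consecutive elements together with the gap from the
  last element around to the first one.
\<close>

definition orbit_points :: "real \<Rightarrow> real \<Rightarrow> nat \<Rightarrow> real set" where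
  "orbit_points A B N = (\<lambda>n. (real n * A) rmod B) ` {0..N}"

definition circular_gaps_le :: "real \<Rightarrow> real set \<Rightarrow> real \<Rightarrow> bool" where
  "circular_gaps_le B S \<delta> \<longleftrightarrow>
     (let xs = sorted_list_of_set S in
       (\<forall>i. Suc i < length xs \<longrightarrow> xs ! Suc i - xs ! i \<le> \<delta>) \<and> hd xs + B - last xs \<le> \<delta>)"

definition covering_time :: "real \<Rightarrow> real \<Rightarrow> real \<Rightarrow> nat" where
  "covering_time A B \<delta> = (LEAST N. 1 \<le> N \<and> circular_gaps_le B (orbit_points A B N) \<delta>)"

end

theory Submission
  imports Defs
begin

text \<open>
  A closed walk of length \<open>A\<close> or \<open>B\<close> may be inserted at \<open>v\<^sup>*\<close> any number of times, so every oriented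
  edge \<open>a = (u \<rightarrow> w)\<close> emits a moving point at all times \<open>p\<^sub>u + n A + m B\<close>. At a late time \<open>t\<close>, the
  positions on \<open>a\<close> of the points emitted with \<open>n \<le> N\<close> form, modulo \<open>B\<close>, a reflected translate of the
  orbit segment \<open>S\<^sub>N\<close>, and the condition \<open>m \<ge> 0\<close> is automatic. Small circular gaps of the orbit
  segment thus make the moving points on the edge \<open>a\<close> alone an \<open>\<epsilon>\<close>-net of \<open>a\<close>.
\<close>

section \<open>Circular gaps and the covering time\<close>

text \<open>Replaces the sorted list by a pointwise covering condition. Half-open intervals
  \<open>[c, c + \<delta>)\<close> match the non-strict gap bound exactly: a gap of length
  \<open>\<delta>\<close> is still filled. As \<open>0 \<in> S\<close>, the wrap-around gap is
  \<open>B - last xs\<close>, so no interval has to be followed across the cut at 0.\<close>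

lemma circular_gaps_le_iff:
  assumes "finite S" "S \<subseteq> {0..<B}" "0 \<in> S" "0 < \<delta>"
  shows "circular_gaps_le B S \<delta> \<longleftrightarrow> (\<forall>y\<in>{0..<B}. \<exists>c\<in>S. c \<le> y \<and> y < c + \<delta>)"
proof -
  define xs where "xs = sorted_list_of_set S"
  have set: "set xs = S" and sorted: "sorted_wrt (<) xs"
    using assms(1) by (simp_all add: xs_def)
  have ne: "xs \<noteq> []" using set assms(3) by auto
  have less: "xs ! i < xs ! j" if "i < j" "j < length xs" for i j
    using sorted that by (simp add: sorted_wrt_iff_nth_less)
  have le: "xs ! i \<le> xs ! j" if "i \<le> j" "j < length xs" for i j
    using less[of i j] that by (cases "i = j") auto
  have last: "last xs = xs ! (length xs - 1)" using ne by (simp add: last_conv_nth)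
  have hd: "hd xs = 0"
  proof -
    obtain k where "k < length xs" "xs ! k = 0" using assms(3) set by (metis in_set_conv_nth)
    moreover have "hd xs = xs ! 0" using ne by (simp add: hd_conv_nth)
    moreover have "hd xs \<in> S" using ne set by auto
    ultimately show ?thesis using le[of 0 k] assms(2) by force
  qed
  have "(\<forall>i. Suc i < length xs \<longrightarrow> xs ! Suc i - xs ! i \<le> \<delta>) \<and> B - last xs \<le> \<delta> \<longleftrightarrow>
    (\<forall>y\<in>{0..<B}. \<exists>c\<in>S. c \<le> y \<and> y < c + \<delta>)" (is "?gaps \<longleftrightarrow> ?cov")
  proof
    assume gaps: ?gaps
    show ?cov
    proof
      fix y assume y: "y \<in> {0..<B}"
      \<comment> \<open>The nearest point of \<open>S\<close> at or below \<open>y\<close>; by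
        maximality its successor in the list, if any, lies beyond \<open>y\<close>.\<close>
      define c where "c = Max {c \<in> S. c \<le> y}"
      have fin: "finite {c \<in> S. c \<le> y}" using assms(1) by simp
      have "{c \<in> S. c \<le> y} \<noteq> {}" using y assms(3) by auto
      then have c: "c \<in> S" "c \<le> y" using Max_in[OF fin] by (auto simp: c_def)
      have max: "d \<le> c" if "d \<in> S" "d \<le> y" for d
        unfolding c_def using fin that by (intro Max_ge) auto
      obtain i where i: "i < length xs" "xs ! i = c" using c(1) set by (metis in_set_conv_nth)
      have "y < c + \<delta>"
      proof (cases "Suc i < length xs")
        case True
        then have "xs ! Suc i - c \<le> \<delta>" "c < xs ! Suc i" "xs ! Suc i \<in> S"
          using gaps i less[of i "Suc i"] set by auto
        then show ?thesis using max[of "xs ! Suc i"] by linarith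
      next
        case False
        then have "i = length xs - 1" using i by simp
        then have "B - c \<le> \<delta>" using gaps last i by simp
        then show ?thesis using y by simp
      qed
      with c show "\<exists>c\<in>S. c \<le> y \<and> y < c + \<delta>" by blast
    qed
  next
    assume cov: ?cov
    show ?gaps
    proof (intro conjI allI impI)
      fix i assume i: "Suc i < length xs"
      show "xs ! Suc i - xs ! i \<le> \<delta>"
      proof (rule ccontr)
        assume neg: "\<not> xs ! Suc i - xs ! i \<le> \<delta>"
        have "xs ! i \<in> {0..<B}" "xs ! Suc i \<in> {0..<B}"
          using i set assms(2) nth_mem[of i xs] nth_mem[of "Suc i" xs] by auto
        \<comment> \<open>The test point \<open>xs ! i + \<delta>\<close> lies strictly inside the
          gap; a point of \<open>S\<close> covering it would fall strictly between two
          neighbours.\<close>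
        then have "xs ! i + \<delta> \<in> {0..<B}" using neg assms(4) by auto
        then obtain c where c: "c \<in> S" "c \<le> xs ! i + \<delta>" "xs ! i + \<delta> < c + \<delta>"
          using cov by blast
        then obtain k where k: "k < length xs" "xs ! k = c" using set by (metis in_set_conv_nth)
        have "i < k" using le[of k i] k c i by (meson add_less_cancel_right leD leI less_trans lessI)
        then have "xs ! Suc i \<le> c" using le[of "Suc i" k] k by simp
        with c(2) neg show False by linarith
      qed
    next
      show "B - last xs \<le> \<delta>"
      proof (rule ccontr)
        assume neg: "\<not> B - last xs \<le> \<delta>"
        have "last xs \<in> {0..<B}" using last_in_set[OF ne] set assms(2) by blast
        \<comment> \<open>Covering this test point would require a point of \<open>S\<close> beyond
          the last one.\<close>
        then have "last xs + \<delta> \<in> {0..<B}" using neg assms(4) by auto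
        then obtain c where c: "c \<in> S" "last xs + \<delta> < c + \<delta>"
          using cov by blast
        then obtain k where k: "k < length xs" "xs ! k = c" using set by (metis in_set_conv_nth)
        then have "k \<le> length xs - 1" "length xs - 1 < length xs" by linarith+
        then show False using le[of k "length xs - 1"] k c(2) last by simp
      qed
    qed
  qed
  then show ?thesis by (simp add: circular_gaps_le_def Let_def hd flip: xs_def)
qed

lemma orbit_points_props:
  assumes "0 < B"
  shows "finite (orbit_points A B N)" "orbit_points A B N \<subseteq> {0..<B}" "0 \<in> orbit_points A B N"
proof -
  show "0 \<in> orbit_points A B N"
    unfolding orbit_points_def by (rule image_eqI[of _ _ 0]) auto
qed (use assms in \<open>auto simp: orbit_points_def rmod_nonneg rmod_less\<close>)

text \<open>Kronecker's density theorem for the multiples of \<open>A / B\<close> modulo 1, rescaled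
  by \<open>B\<close>: the target \<open>\<alpha>\<close> is the midpoint of the interval and the
  tolerance is half its width.\<close>

lemma orbit_point_in_interval:
  assumes "0 < B" "A / B \<notin> \<rat>" "0 \<le> c" "c < d" "d \<le> B"
  shows "\<exists>k. c < (real k * A) rmod B \<and> (real k * A) rmod B < d"
proof -
  define \<alpha> where "\<alpha> = (c + d) / (2 * B)"
  have "0 \<le> \<alpha>" "\<alpha> \<le> 1" "0 < (d - c) / (2 * B)"
    using assms by (auto simp: \<alpha>_def field_simps)
  from Kronecker_approx_1_explicit[OF assms(2) this] obtain k
    where "\<bar>frac (real k * (A / B)) - \<alpha>\<bar> < (d - c) / (2 * B)" by blast
  then have "\<bar>frac (real k * (A / B)) - \<alpha>\<bar> * B < (d - c) / (2 * B) * B"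
    using assms(1) by (intro mult_strict_right_mono)
  also have "(d - c) / (2 * B) * B = (d - c) / 2" using assms(1) by simp
  also have "\<bar>frac (real k * (A / B)) - \<alpha>\<bar> * B = \<bar>(frac (real k * (A / B)) - \<alpha>) * B\<bar>"
    using assms(1) by (simp add: abs_mult)
  also have "(frac (real k * (A / B)) - \<alpha>) * B = (real k * A) rmod B - (c + d) / 2"
    using assms(1) by (simp add: rmod_conv_frac \<alpha>_def left_diff_distrib)
  finally show ?thesis
    unfolding abs_less_iff by (intro exI[of _ k] conjI) argo+
qed

text \<open>Guarantees that the \<open>LEAST\<close> in \<open>covering_time\<close> is attained.
  The circle is cut into \<open>M\<close> cells, density gives an orbit point in each, and finitely
  many indices have a maximum.\<close>

lemma ex_covering:
  assumes "0 < B" "A / B \<notin> \<rat>" "0 < \<delta>"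
  shows "\<exists>N\<ge>1. circular_gaps_le B (orbit_points A B N) \<delta>"
proof -
  \<comment> \<open>Two cells together must be shorter than \<open>\<delta>\<close>, because
    \<open>y\<close> will be covered from the cell to the left of its own.\<close>
  obtain M :: nat where M: "2 * B / \<delta> < real M" using reals_Archimedean2 by blast
  moreover have "0 < 2 * B / \<delta>" using assms by simp
  ultimately have M0: "0 < real M" by linarith
  define h where "h = B / real M"
  have h: "0 < h" "2 * h < \<delta>" "real M * h = B"
    using assms(1,3) M M0 by (auto simp: h_def field_simps)
  have "\<exists>k. real j * h < (real k * A) rmod B \<and> (real k * A) rmod B < real (Suc j) * h"
    if "j < M" for j
  proof (rule orbit_point_in_interval[OF assms(1,2)])
    have "real (Suc j) * h \<le> real M * h" using that h by (intro mult_right_mono) auto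
    then show "real (Suc j) * h \<le> B" using h by simp
  qed (use h in \<open>auto simp: algebra_simps\<close>)
  then obtain K where K: "\<And>j. j < M \<Longrightarrow>
    real j * h < (real (K j) * A) rmod B \<and> (real (K j) * A) rmod B < real (Suc j) * h"
    by metis
  \<comment> \<open>The successor ensures \<open>1 \<le> N\<close>.\<close>
  define N where "N = Suc (Max (K ` {..<M}))"
  have K_le: "K j \<le> N" if "j < M" for j
    unfolding N_def using that by (intro le_SucI Max_ge) auto
  have "\<exists>c\<in>orbit_points A B N. c \<le> y \<and> y < c + \<delta>" if y: "y \<in> {0..<B}" for y
  proof -
    define j where "j = nat \<lfloor>y / h\<rfloor>"
    have "real j = of_int \<lfloor>y / h\<rfloor>" using y h by (simp add: j_def)
    then have "real j \<le> y / h" "y / h < real j + 1" by linarith+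
    then have j: "real j * h \<le> y" "y < (real j + 1) * h"
      using h by (simp_all add: field_simps)
    have "real j * h < real M * h" using j(1) y h by simp
    then have "j < M" using h(1) by (simp only: mult_less_cancel_right_pos of_nat_less_iff)
    \<comment> \<open>The orbit point in the cell of \<open>y\<close> may lie above
      \<open>y\<close>, so the one in the preceding cell is taken; for the first cell the orbit
      point 0 serves.\<close>
    show ?thesis
    proof (cases j)
      case 0
      then show ?thesis using orbit_points_props(3)[OF assms(1)] j y h by (intro bexI[of _ 0]) auto
    next
      case (Suc i)
      then have "i < M" using \<open>j < M\<close> by simp
      then have "(real (K i) * A) rmod B \<in> orbit_points A B N"
        using K_le by (auto simp: orbit_points_def)
      moreover have "real j * h = real i * h + h" "(real j + 1) * h = real i * h + 2 * h"
        using Suc by (simp_all add: algebra_simps)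
      ultimately show ?thesis
        using K[OF \<open>i < M\<close>] j h Suc by (intro bexI[of _ "(real (K i) * A) rmod B"]) auto
    qed
  qed
  then have "circular_gaps_le B (orbit_points A B N) \<delta>"
    using circular_gaps_le_iff[OF orbit_points_props[OF assms(1)] assms(3)] by blast
  then show ?thesis by (intro exI[of _ N]) (simp add: N_def)
qed

text \<open>The covering property at \<open>y rmod B\<close> gives \<open>n \<le> N\<close> and an
  integer \<open>k\<close> with \<open>y - n A - k B\<close> in \<open>[0, \<delta>)\<close>. The
  lower bound on \<open>y\<close> makes \<open>k\<close> positive, hence a legitimate number of
  laps.\<close>

lemma covering_time_approx:
  assumes "0 < A" "0 < B" "A / B \<notin> \<rat>" "0 < \<delta>" "A * real (covering_time A B \<delta>) + B \<le> y"
  shows "\<exists>n m :: nat. 0 \<le> y - (real n * A + real m * B) \<and> y - (real n * A + real m * B) < \<delta>"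
proof -
  define N where "N = covering_time A B \<delta>"
  have "circular_gaps_le B (orbit_points A B N) \<delta>"
    unfolding N_def covering_time_def using LeastI_ex[OF ex_covering[OF assms(2-4)]] by blast
  moreover have "y rmod B \<in> {0..<B}" using assms(2) by (simp add: rmod_nonneg rmod_less)
  ultimately obtain c where "c \<in> orbit_points A B N" "c \<le> y rmod B" "y rmod B < c + \<delta>"
    using circular_gaps_le_iff[OF orbit_points_props[OF assms(2)] assms(4)] by blast
  then obtain n where n: "n \<le> N"
    "(real n * A) rmod B \<le> y rmod B" "y rmod B < (real n * A) rmod B + \<delta>"
    unfolding orbit_points_def by auto
  define k where "k = \<lfloor>y / B\<rfloor> - \<lfloor>real n * A / B\<rfloor>"
  have eq: "y - real n * A - of_int k * B = y rmod B - (real n * A) rmod B"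
    using assms(2) by (simp add: k_def rmod_def algebra_simps)
  have "y rmod B - (real n * A) rmod B < B"
    using rmod_less[OF assms(2), of y] rmod_nonneg[of B "real n * A"] assms(2) by linarith
  moreover have "real n * A \<le> A * real N" using n(1) assms(1) by simp
  \<comment> \<open>Here \<open>y - n A \<ge> B\<close>, while \<open>y - n A - k B\<close> is a
    difference of two residues and so less than \<open>B\<close>.\<close>
  ultimately have "0 < of_int k * B" using eq assms(5) by (simp add: N_def)
  then have "0 < k" using assms(2) by (simp add: zero_less_mult_iff)
  then have "real (nat k) = of_int k" by simp
  with eq n(2,3) show ?thesis by (intro exI[of _ n] exI[of _ "nat k"]) (simp add: algebra_simps)
qed

section \<open>Creation times along walks\<close>

lemma walk_length_Cons: "walk_length G (u # v # xs) = len G {u, v} + walk_length G (v # xs)"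
  by (simp add: walk_length_def sum.lessThan_Suc_shift del: sum.lessThan_Suc)

lemma walk_from_to_Cons:
  "walk_from_to G a (u # v # xs) w \<longleftrightarrow>
    a = u \<and> u \<in> verts G \<and> {u, v} \<in> edges G \<and> walk_from_to G v (v # xs) w"
  by (auto simp: walk_from_to_def All_less_Suc2)

lemma walk_length_nonneg:
  assumes "metric_graph G" "walk_from_to G u xs w"
  shows "0 \<le> walk_length G xs"
  unfolding walk_length_def
  using assms by (intro sum_nonneg) (auto simp: walk_from_to_def metric_graph_def less_imp_le)

text \<open>An arrival at a vertex creates points on all outgoing edges at once. The assumption
  therefore covers every edge issuing from \<open>u\<close> at a general time \<open>s\<close>, a
  property that each step of the walk hands on to the next vertex.\<close>

lemma created_along_walk:
  assumes "\<And>w. (u, w) \<in> oriented_edges G \<Longrightarrow> created G v\<^sub>0 s (u, w)"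
    and "walk_from_to G u xs v" "(v, z) \<in> oriented_edges G"
  shows "created G v\<^sub>0 (s + walk_length G xs) (v, z)"
  using assms
proof (induction xs arbitrary: u s)
  case Nil
  then show ?case by (simp add: walk_from_to_def)
next
  case (Cons x ys)
  show ?case
  proof (cases ys)
    case Nil
    then show ?thesis using Cons.prems by (auto simp: walk_from_to_def walk_length_def)
  next
    case (Cons y zs)
    with Cons.prems have walk: "u = x" "{x, y} \<in> edges G" "walk_from_to G y ys v"
      by (auto simp: walk_from_to_Cons)
    then have "created G v\<^sub>0 s (x, y)" using Cons.prems(1) by (simp add: oriented_edges_def)
    then have "created G v\<^sub>0 (s + len G {x, y}) (y, w)" if "(y, w) \<in> oriented_edges G" for w
      using created.arrival that by (fastforce simp: olen_def)
    from Cons.IH[OF this walk(3) Cons.prems(3)] show ?thesis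
      by (simp add: Cons walk_length_Cons add.assoc)
  qed
qed

lemma created_iterate_closed_walk:
  assumes "\<And>w. (v, w) \<in> oriented_edges G \<Longrightarrow> created G v\<^sub>0 s (v, w)"
    and "closed_walk G v C" "(v, z) \<in> oriented_edges G"
  shows "created G v\<^sub>0 (s + real n * walk_length G C) (v, z)"
  using assms(3)
proof (induction n arbitrary: z)
  case (Suc n)
  from created_along_walk[OF Suc.IH assms(2) Suc.prems] show ?case by (simp add: algebra_simps)
qed (use assms(1) in simp)

text \<open>Concatenates \<open>n\<close> laps of the first closed walk, \<open>m\<close> laps of
  the second, and the walk to \<open>u\<close>.\<close>

lemma created_at_combination:
  assumes "closed_walk G v C\<^sub>1" "closed_walk G v C\<^sub>2" "walk_from_to G v xs u"
    and "(u, w) \<in> oriented_edges G"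
  shows "created G v (real n * walk_length G C\<^sub>1 + real m * walk_length G C\<^sub>2 + walk_length G xs) (u, w)"
proof -
  have "created G v (real n * walk_length G C\<^sub>1) (v, z)" if "(v, z) \<in> oriented_edges G" for z
    using created_iterate_closed_walk[OF created.initial assms(1) that, of n] by simp
  from created_along_walk[OF created_iterate_closed_walk[OF this assms(2)] assms(3,4)]
  show ?thesis .
qed

section \<open>Saturation\<close>

lemma graph_dist_edge_le:
  assumes "a \<in> oriented_edges G" "x \<in> {0..olen G a}" "y \<in> {0..olen G a}"
  shows "graph_dist G (edge_point G a x) (edge_point G a y) \<le> ereal \<bar>x - y\<bar>"
proof -
  have "edge_point G a x \<in> graph_points G"
    unfolding graph_points_def using assms by (intro UnI2 CollectI exI[of _ a] exI[of _ x]) auto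
  from path_between.move[OF path_between.start[OF this] assms]
  show ?thesis unfolding graph_dist_def by (auto intro!: Inf_lower)
qed

lemma metric_graph_oriented_edgeD:
  assumes "metric_graph G" "(u, w) \<in> oriented_edges G"
  shows "u \<in> verts G" "w \<in> verts G" "0 < olen G (u, w)"
  using assms unfolding metric_graph_def oriented_edges_def olen_def
  by (fastforce simp: doubleton_eq_iff)+

lemma finite_oriented_edges:
  assumes "metric_graph G" "finite (verts G)"
  shows "finite (oriented_edges G)"
  using metric_graph_oriented_edgeD[OF assms(1)] assms(2)
  by (intro finite_subset[of "oriented_edges G" "verts G \<times> verts G"]) auto

lemma finite_edges:
  assumes "metric_graph G" "finite (verts G)"
  shows "finite (edges G)"
  using assms by (intro finite_subset[of "edges G" "Pow (verts G)"]) (fastforce simp: metric_graph_def)+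

lemma walk_first_edge:
  assumes "walk_from_to G v xs w" "1 < length xs"
  obtains z where "(v, z) \<in> oriented_edges G"
proof -
  from assms(2) obtain x y ys where "xs = x # y # ys"
    by (cases xs rule: remdups_adj.cases) auto
  with assms(1) have "(v, y) \<in> oriented_edges G" by (simp add: walk_from_to_Cons oriented_edges_def)
  then show thesis by (rule that)
qed

text \<open>Isolated vertices have to be excluded: \<open>v\<close> has an edge because
  \<open>C\<close> has nonzero length, and any other vertex has one on a walk joining it to
  \<open>v\<close>.\<close>

lemma graph_point_on_edge:
  assumes "metric_graph G" "connected_graph G" "v \<in> verts G"
    and "closed_walk G v C" "walk_length G C \<noteq> 0" "q \<in> graph_points G"
  obtains a x where "a \<in> oriented_edges G" "x \<in> {0..olen G a}" "q = edge_point G a x"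
proof -
  have edge: "\<exists>z. (u, z) \<in> oriented_edges G" if u: "u \<in> verts G" for u
  proof (cases "u = v")
    case True
    have "1 < length C" using assms(5) by (cases C) (auto simp: walk_length_def)
    with assms(4) True show ?thesis by (metis walk_first_edge)
  next
    case False
    obtain xs where xs: "walk_from_to G u xs v"
      using assms(2,3) u by (auto simp: connected_graph_def)
    then have "1 < length xs" using False by (cases xs) (auto simp: walk_from_to_def)
    with xs show ?thesis by (metis walk_first_edge)
  qed
  have vertex: "\<exists>a x. a \<in> oriented_edges G \<and> x \<in> {0..olen G a} \<and> vertex_point u = edge_point G a x"
    if u: "u \<in> verts G" for u
  proof -
    obtain z where z: "(u, z) \<in> oriented_edges G" using edge[OF u] by blast
    then have "0 \<in> {0..olen G (u, z)}" using metric_graph_oriented_edgeD(3)[OF assms(1) z] by simp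
    with z show ?thesis by (metis edge_point_0)
  qed
  from assms(6) consider u where "u \<in> verts G" "q = vertex_point u"
    | a x where "a \<in> oriented_edges G" "0 \<le> x" "x \<le> olen G a" "q = edge_point G a x"
    unfolding graph_points_def by blast
  then show thesis
  proof cases
    case 1
    then show ?thesis using vertex that by blast
  next
    case 2
    then show ?thesis using that by simp
  qed
qed

text \<open>Each \<open>q\<close> is approximated by a point moving on an edge that contains
  \<open>q\<close>, so only distances within one closed edge are needed.\<close>

lemma saturated_if_late:
  assumes G: "metric_graph G" "connected_graph G" "v \<in> verts G"
    and C: "closed_walk G v C\<^sub>1" "closed_walk G v C\<^sub>2"
    and AB: "A = walk_length G C\<^sub>1" "B = walk_length G C\<^sub>2" "0 < A" "0 < B" "A / B \<notin> \<rat>"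
    and P: "\<And>u. u \<in> verts G \<Longrightarrow> walk_from_to G v (P u) u"
    and \<epsilon>: "0 < \<epsilon>" "\<And>a. a \<in> oriented_edges G \<Longrightarrow> \<epsilon> < olen G a"
    and t: "\<And>u w. (u, w) \<in> oriented_edges G \<Longrightarrow>
      walk_length G (P u) + A * real (covering_time A B \<epsilon>) + B + olen G (u, w) \<le> t"
  shows "saturated G v \<epsilon> t"
  unfolding saturated_def
proof
  fix q assume "q \<in> graph_points G"
  with G C(1) AB obtain a x where
    a: "a \<in> oriented_edges G" and x: "x \<in> {0..olen G a}" and q: "q = edge_point G a x"
    by (metis graph_point_on_edge less_irrefl)
  obtain u w where uw: "a = (u, w)" by (cases a)
  \<comment> \<open>Shifting away from the head ensures that the point found in \<open>[x', x' + \<epsilon>)\<close> has not left \<open>a\<close>.\<close>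
  define x' where "x' = min x (olen G a - \<epsilon>)"
  \<comment> \<open>Subtracting \<open>x'\<close> costs at most the edge length, which accounts for
    the summand \<open>olen G (u, w)\<close> in the bound.\<close>
  have "A * real (covering_time A B \<epsilon>) + B \<le> t - walk_length G (P u) - x'"
    using t[of u w] a uw x by (auto simp: x'_def min_def)
  from covering_time_approx[OF AB(3-5) \<epsilon>(1) this] obtain n m :: nat where
    nm: "0 \<le> t - walk_length G (P u) - x' - (real n * A + real m * B)"
      "t - walk_length G (P u) - x' - (real n * A + real m * B) < \<epsilon>" by blast
  define s where "s = real n * A + real m * B + walk_length G (P u)"
  have s: "x' \<le> t - s" "t - s < x' + \<epsilon>" using nm by (auto simp: s_def)
  have x': "0 \<le> x'" "x' \<le> x" "x \<le> x' + \<epsilon>" "x' + \<epsilon> \<le> olen G a"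
    using x \<epsilon>(2)[OF a] \<epsilon>(1) by (auto simp: x'_def min_def)
  have "u \<in> verts G" using metric_graph_oriented_edgeD[OF G(1)] a uw by blast
  then have "created G v s a"
    using created_at_combination[OF C P] a uw by (simp add: s_def AB(1,2))
  then have moving: "(a, t - s) \<in> moving_points G v t"
    using s x' unfolding moving_points_def by (intro CollectI exI[of _ a] exI[of _ s]) auto
  \<comment> \<open>Both \<open>x\<close> and \<open>t - s\<close> lie in
    \<open>[x', x' + \<epsilon>]\<close>.\<close>
  have "graph_dist G q (edge_point G a (t - s)) \<le> ereal \<bar>x - (t - s)\<bar>"
    unfolding q using a x s x' by (intro graph_dist_edge_le) auto
  also have "\<dots> \<le> ereal \<epsilon>" using s x' by auto
  finally show "\<exists>(a, x)\<in>moving_points G v t. graph_dist G q (edge_point G a x) \<le> ereal \<epsilon>"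
    using moving by blast
qed

theorem theorem3p4:
  fixes G :: "'v mgraph"
    and vstar :: 'v
    and C1 C2 :: "'v list"
    and A B \<epsilon> :: real
    and P :: "'v \<Rightarrow> 'v list"
    and p :: "'v \<Rightarrow> real"
  assumes "metric_graph G"
    and "finite (verts G)"
    and "connected_graph G"
    and "vstar \<in> verts G"
    and "closed_walk G vstar C1"
    and "closed_walk G vstar C2"
    and "A = walk_length G C1"
    and "B = walk_length G C2"
    and "A / B \<notin> \<rat>"
    and "\<And>u. u \<in> verts G \<Longrightarrow> walk_from_to G vstar (P u) u"
    and "\<And>u. u \<in> verts G \<Longrightarrow> p u = walk_length G (P u)"
    and "0 < \<epsilon>"
    and "\<epsilon> < Min (len G ` edges G)"
  shows "saturation_moment G vstar \<epsilon> \<le>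
    ereal (Max {p u + A * real (covering_time A B \<epsilon>) + B + olen G (u, w) | u w.
      (u, w) \<in> oriented_edges G})"
proof -
  let ?T = "{p u + A * real (covering_time A B \<epsilon>) + B + olen G (u, w) | u w.
      (u, w) \<in> oriented_edges G}"
  \<comment> \<open>If either length were zero, the quotient would be 0 and hence rational; this
    includes division by zero, whose value is 0.\<close>
  have AB: "0 < A" "0 < B"
    using walk_length_nonneg[OF assms(1)] assms(5-9) by (fastforce simp: order_less_le)+
  have "?T = (\<lambda>(u, w). p u + A * real (covering_time A B \<epsilon>) + B + olen G (u, w)) ` oriented_edges G"
    by auto
  then have fin: "finite ?T" using finite_oriented_edges[OF assms(1,2)] by simp
  \<comment> \<open>An edge at \<open>vstar\<close> provides a nonnegative element of
    \<open>?T\<close>, so \<open>Max ?T\<close> is nonnegative and admissible in the infimum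
    defining the saturation moment.\<close>
  have "1 < length C1" using AB(1) assms(7) by (cases C1) (auto simp: walk_length_def)
  with assms(5) obtain z where z: "(vstar, z) \<in> oriented_edges G" by (metis walk_first_edge)
  have "\<epsilon> < olen G a" if "a \<in> oriented_edges G" for a
  proof -
    have "{fst a, snd a} \<in> edges G" using that by (auto simp: oriented_edges_def)
    then have "Min (len G ` edges G) \<le> olen G a"
      unfolding olen_def using finite_edges[OF assms(1,2)] by (intro Min_le) auto
    with assms(13) show ?thesis by simp
  qed
  moreover have bound: "walk_length G (P u) + A * real (covering_time A B \<epsilon>) + B + olen G (u, w) \<le> Max ?T"
    if "(u, w) \<in> oriented_edges G" for u w
    using that metric_graph_oriented_edgeD(1)[OF assms(1) that] assms(11)
    by (intro Max_ge[OF fin]) force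
  ultimately have "saturated G vstar \<epsilon> t" if "Max ?T \<le> t" for t
    using saturated_if_late[OF assms(1,3-8) AB assms(9,10,12)] that by (meson order_trans)
  moreover have "0 \<le> walk_length G (P vstar)"
    by (rule walk_length_nonneg[OF assms(1) assms(10)[OF assms(4)]])
  then have "0 \<le> walk_length G (P vstar) + A * real (covering_time A B \<epsilon>) + B + olen G (vstar, z)"
    using AB metric_graph_oriented_edgeD(3)[OF assms(1) z] by simp
  with bound[OF z] have "0 \<le> Max ?T" by linarith
  ultimately show ?thesis
    unfolding saturation_moment_def by (intro Inf_lower) blast
qed

end
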